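(* Let $n\ge 1$ and let $g=(A,w)$ be an element of $\mathrm{SU}(n)\ltimes\mathbb{C}^n$, where $A\neq I_n$. Then the following are equivalent. (1) $g$ is reversible in $\mathrm{SU}(n)\ltimes\mathbb{C}^n$. (2) $A$ is reversible in $\mathrm{SU}(n)$. (3) The characteristic polynomial of $A$ is self-dual. Moreover, when $A=I_n$ and $n\ge2$, the element $g=(I_n,w)$ is strongly reversible in $\mathrm{SU}(n)\ltimes\mathbb{C}^n$ (for every $w\in\mathbb{C}^n$).
   Context: $\mathrm{SU}(n)$ is the group of complex unitary $n\times n$ matrices of determinant $1$. Elements of $\mathrm{SU}(n)\ltimes\mathbb{C}^n$ are pairs $(A,w)$ with $A\in\mathrm{SU}(n)$, $w\in\mathbb{C}^n$, acting as the affine maps $z\mapsto Az+w$ of $\mathbb{C}^n$; the group operation is composition. An element $g$ of a group $G$ is reversible in $G$ if there is $h\in G$ with $hgh^{-1}=g^{-1}$, and strongly reversible in $G$ if such an $h$ can be chosen with $h^2=1$. For a unitary matrix $A$, the characteristic polynomial of $A$ is self-dual if whenever $\lambda\neq\pm1$ is a root of it, so is $\lambda^{-1}$, with the same multiplicity. *)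

theory Defs
  imports "HOL-Algebra.Group" "Jordan_Normal_Form.Char_Poly" "Jordan_Normal_Form.Schur_Decomposition"
begin

definition reversible :: "('a, 'b) monoid_scheme \<Rightarrow> 'a \<Rightarrow> bool" where
  "reversible G g \<longleftrightarrow>
     (\<exists>h\<in>carrier G. h \<otimes>\<^bsub>G\<^esub> g \<otimes>\<^bsub>G\<^esub> inv\<^bsub>G\<^esub> h = inv\<^bsub>G\<^esub> g)"

definition strongly_reversible :: "('a, 'b) monoid_scheme \<Rightarrow> 'a \<Rightarrow> bool" where
  "strongly_reversible G g \<longleftrightarrow>
     (\<exists>h\<in>carrier G. h \<otimes>\<^bsub>G\<^esub> g \<otimes>\<^bsub>G\<^esub> inv\<^bsub>G\<^esub> h = inv\<^bsub>G\<^esub> g \<and> h \<otimes>\<^bsub>G\<^esub> h = \<one>\<^bsub>G\<^esub>)"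

definition SU :: "nat \<Rightarrow> complex mat monoid" where
  "SU n = \<lparr>carrier = {A \<in> carrier_mat n n. mat_adjoint A * A = 1\<^sub>m n \<and> det A = 1},
           monoid.mult = (*), one = 1\<^sub>m n\<rparr>"

definition affine_act :: "complex mat \<times> complex vec \<Rightarrow> complex vec \<Rightarrow> complex vec" where
  "affine_act g z = fst g *\<^sub>v z + snd g"

text \<open>The product is the one that makes \<^const>\<open>affine_act\<close> turn products into compositions;
  see \<open>affine_act_mult\<close> below.\<close>

definition SU_affine :: "nat \<Rightarrow> (complex mat \<times> complex vec) monoid" where
  "SU_affine n = \<lparr>carrier = carrier (SU n) \<times> carrier_vec n,
                  monoid.mult = (\<lambda>(A, w) (B, v). (A * B, A *\<^sub>v v + w)),
                  one = (1\<^sub>m n, 0\<^sub>v n)\<rparr>"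

text \<open>Multiplicity of a root is \<^const>\<open>Polynomial.order\<close>. Only polynomials with nonzero constant term
  are of interest (characteristic polynomials of unitary matrices), so that \<open>inverse 0 = 0\<close>
  plays no role.\<close>

definition self_dual :: "complex poly \<Rightarrow> bool" where
  "self_dual p \<longleftrightarrow>
     (\<forall>\<mu>. \<mu> \<noteq> 1 \<and> \<mu> \<noteq> -1 \<and> poly p \<mu> = 0 \<longrightarrow>
        poly p (inverse \<mu>) = 0 \<and> Polynomial.order (inverse \<mu>) p = Polynomial.order \<mu> p)"

lemma affine_act_mult:
  assumes "g \<in> carrier (SU_affine n)" "h \<in> carrier (SU_affine n)" "z \<in> carrier_vec n"
  shows "affine_act (g \<otimes>\<^bsub>SU_affine n\<^esub> h) z = affine_act g (affine_act h z)"
  using assms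
  by (auto simp: SU_affine_def SU_def affine_act_def mult_add_distrib_mat_vec[of _ n n]
      assoc_add_vec[of _ n])

lemma mat_adjoint_carrier: "A \<in> carrier_mat n n \<Longrightarrow> mat_adjoint A \<in> carrier_mat n n"
  by (auto simp: mat_adjoint_def)

lemma index_mat_adjoint:
  assumes "A \<in> carrier_mat n n" "i < n" "j < n"
  shows "mat_adjoint A $$ (i, j) = conjugate (A $$ (j, i))"
  using assms by (auto simp: mat_adjoint_def mat_of_rows_index)

lemma mat_adjoint_mult:
  fixes A B :: "complex mat"
  assumes "A \<in> carrier_mat n n" "B \<in> carrier_mat n n"
  shows "mat_adjoint (A * B) = mat_adjoint B * mat_adjoint A"
proof (rule eq_matI)
  note c = assms mat_adjoint_carrier[OF assms(1)] mat_adjoint_carrier[OF assms(2)]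
    mat_adjoint_carrier[OF mult_carrier_mat[OF assms]]
  show "dim_row (mat_adjoint (A * B)) = dim_row (mat_adjoint B * mat_adjoint A)"
    "dim_col (mat_adjoint (A * B)) = dim_col (mat_adjoint B * mat_adjoint A)"
    using c by auto
  fix i j assume "i < dim_row (mat_adjoint B * mat_adjoint A)"
    "j < dim_col (mat_adjoint B * mat_adjoint A)"
  then have ij: "i < n" "j < n" using c by auto
  show "mat_adjoint (A * B) $$ (i, j) = (mat_adjoint B * mat_adjoint A) $$ (i, j)"
    using c ij
    by (simp add: index_mat_adjoint[where n = n] scalar_prod_def cnj_sum mult.commute)
qed

lemma mat_adjoint_one: "mat_adjoint (1\<^sub>m n :: complex mat) = 1\<^sub>m n"
  by (rule eq_matI) (auto simp: index_mat_adjoint[where n = n] mat_adjoint_def mat_of_rows_index)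

lemma group_SU: "group (SU n)"
proof (rule groupI)
  fix A B assume "A \<in> carrier (SU n)" "B \<in> carrier (SU n)"
  then have A: "A \<in> carrier_mat n n" "mat_adjoint A * A = 1\<^sub>m n" "det A = 1"
    and B: "B \<in> carrier_mat n n" "mat_adjoint B * B = 1\<^sub>m n" "det B = 1"
    by (auto simp: SU_def)
  note c = A(1) B(1) mat_adjoint_carrier[OF A(1)] mat_adjoint_carrier[OF B(1)]
  have "mat_adjoint (A * B) * (A * B) = mat_adjoint B * (mat_adjoint A * A) * B"
    using c by (simp add: mat_adjoint_mult[OF A(1) B(1)] assoc_mult_mat[of _ n n _ n _ n])
  also have "\<dots> = 1\<^sub>m n" using c A(2) B(2) by simp
  finally show "A \<otimes>\<^bsub>SU n\<^esub> B \<in> carrier (SU n)"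
    using A B by (auto simp: SU_def det_mult)
next
  show "\<one>\<^bsub>SU n\<^esub> \<in> carrier (SU n)"
    by (auto simp: SU_def mat_adjoint_one)
next
  fix A B C assume "A \<in> carrier (SU n)" "B \<in> carrier (SU n)" "C \<in> carrier (SU n)"
  then show "A \<otimes>\<^bsub>SU n\<^esub> B \<otimes>\<^bsub>SU n\<^esub> C = A \<otimes>\<^bsub>SU n\<^esub> (B \<otimes>\<^bsub>SU n\<^esub> C)"
    by (auto simp: SU_def)
next
  fix A assume "A \<in> carrier (SU n)"
  then show "\<one>\<^bsub>SU n\<^esub> \<otimes>\<^bsub>SU n\<^esub> A = A"
    by (auto simp: SU_def)
next
  fix A assume "A \<in> carrier (SU n)"
  then have A: "A \<in> carrier_mat n n" "mat_adjoint A * A = 1\<^sub>m n" "det A = 1"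
    by (auto simp: SU_def)
  note c = A(1) mat_adjoint_carrier[OF A(1)]
  have AA: "A * mat_adjoint A = 1\<^sub>m n"
    using mat_mult_left_right_inverse[OF c(2,1) A(2)] .
  have "mat_adjoint (mat_adjoint A) = A"
    using c by (intro eq_matI)
      (auto simp: index_mat_adjoint[where n = n] mat_adjoint_def[of "mat_adjoint A"] mat_of_rows_index)
  moreover have "det (mat_adjoint A) = 1"
    using det_mult[OF c(2,1)] A by simp
  ultimately have "mat_adjoint A \<in> carrier (SU n)"
    using c AA by (auto simp: SU_def)
  then show "\<exists>B\<in>carrier (SU n). B \<otimes>\<^bsub>SU n\<^esub> A = \<one>\<^bsub>SU n\<^esub>"
    using A by (auto simp: SU_def)
qed

lemma group_SU_affine: "group (SU_affine n)"
proof (rule groupI)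
  fix g h assume "g \<in> carrier (SU_affine n)" "h \<in> carrier (SU_affine n)"
  then show "g \<otimes>\<^bsub>SU_affine n\<^esub> h \<in> carrier (SU_affine n)"
    using monoid.m_closed[OF group.is_monoid[OF group_SU[of n]]]
    by (fastforce simp: SU_affine_def SU_def)
next
  show "\<one>\<^bsub>SU_affine n\<^esub> \<in> carrier (SU_affine n)"
    by (auto simp: SU_affine_def SU_def mat_adjoint_one)
next
  fix f g h
  assume "f \<in> carrier (SU_affine n)" "g \<in> carrier (SU_affine n)" "h \<in> carrier (SU_affine n)"
  then show "f \<otimes>\<^bsub>SU_affine n\<^esub> g \<otimes>\<^bsub>SU_affine n\<^esub> h = f \<otimes>\<^bsub>SU_affine n\<^esub> (g \<otimes>\<^bsub>SU_affine n\<^esub> h)"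
    by (auto simp: SU_affine_def SU_def mult_add_distrib_mat_vec[of _ n n] assoc_add_vec[of _ n])
next
  fix g assume "g \<in> carrier (SU_affine n)"
  then show "\<one>\<^bsub>SU_affine n\<^esub> \<otimes>\<^bsub>SU_affine n\<^esub> g = g"
    by (auto simp: SU_affine_def SU_def)
next
  fix g assume "g \<in> carrier (SU_affine n)"
  then obtain A w where g: "g = (A, w)" "A \<in> carrier (SU n)" "w \<in> carrier_vec n"
    by (auto simp: SU_affine_def)
  obtain B where B: "B \<in> carrier (SU n)" "B * A = 1\<^sub>m n"
    using group.l_inv_ex[OF group_SU g(2)] by (auto simp: SU_def)
  have Bc: "B \<in> carrier_mat n n" using B by (simp add: SU_def)
  have "B *\<^sub>v w + - (B *\<^sub>v w) = 0\<^sub>v n"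
    using Bc g(3) by (simp add: uminus_r_inv_vec[of _ n])
  then have "(B, - (B *\<^sub>v w)) \<otimes>\<^bsub>SU_affine n\<^esub> g = \<one>\<^bsub>SU_affine n\<^esub>"
    using B g by (simp add: SU_affine_def)
  moreover have "(B, - (B *\<^sub>v w)) \<in> carrier (SU_affine n)"
    using B Bc g by (simp add: SU_affine_def)
  ultimately show "\<exists>h\<in>carrier (SU_affine n). h \<otimes>\<^bsub>SU_affine n\<^esub> g = \<one>\<^bsub>SU_affine n\<^esub>"
    by blast
qed

end

theory Submission
  imports Defs "Jordan_Normal_Form.Spectral_Radius"
begin

text \<open>Conjugating g = (A, w) to its inverse by (B, v) amounts to A B A = B together with the vector
  equation (1 - A) v = A B w + w. Diagonalize A = P D P* with P unitary. The first equation makes A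
  similar to A*, so the spectrum is invariant under inversion. Conversely, for a self-dual
  characteristic polynomial take B = P Q P*, where Q permutes the eigenvectors so that eigenvalues
  are inverted, fixing the indices with eigenvalue 1 and with all entries equal to -1 except one
  phase at an eigenvalue other than 1 (it exists because A is not the identity), which
  corrects the determinant. Then Q acts as -1 on the kernel of 1 - D, which is exactly what makes
  the vector equation solvable. For a translation by w, an involution that is -1 on a plane
  containing w and 1 on its orthogonal complement does the job.\<close>

section \<open>Unitary matrices of arbitrary determinant\<close>

text \<open>The full unitary group is wanted besides \<open>SU n\<close>, because a matrix of
  orthonormal eigenvectors comes with no control over its determinant.\<close>

definition unitary_mat :: "nat \<Rightarrow> complex mat \<Rightarrow> bool" where
  "unitary_mat n U \<longleftrightarrow> U \<in> carrier_mat n n \<and> mat_adjoint U * U = 1\<^sub>m n"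

lemma carrier_SU_iff: "A \<in> carrier (SU n) \<longleftrightarrow> unitary_mat n A \<and> det A = 1"
  by (auto simp: SU_def unitary_mat_def)

lemma mat_adjoint_adjoint:
  fixes A :: "complex mat"
  assumes "A \<in> carrier_mat n n"
  shows "mat_adjoint (mat_adjoint A) = A"
  using assms mat_adjoint_carrier[OF assms] mat_adjoint_carrier[OF mat_adjoint_carrier[OF assms]]
  by (intro eq_matI) (auto simp: index_mat_adjoint[where n = n])

lemma unitary_mat_adjoint_right:
  assumes "unitary_mat n U"
  shows "U * mat_adjoint U = 1\<^sub>m n"
  using assms mat_mult_left_right_inverse[of "mat_adjoint U" n U] mat_adjoint_carrier[of U n]
  by (simp add: unitary_mat_def)

text \<open>Stated in the right-nested form that rewriting with \<open>assoc_mult_mat\<close>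
  produces, so that an inner pair of adjoint factors cancels inside a longer product.\<close>

lemma unitary_mat_cancel:
  assumes "unitary_mat n U" "X \<in> carrier_mat n m"
  shows "mat_adjoint U * (U * X) = X" "U * (mat_adjoint U * X) = X"
proof -
  have c: "U \<in> carrier_mat n n" "mat_adjoint U \<in> carrier_mat n n"
    using assms mat_adjoint_carrier by (auto simp: unitary_mat_def)
  show "mat_adjoint U * (U * X) = X"
    using assms c by (simp add: unitary_mat_def flip: assoc_mult_mat[OF c(2,1) assms(2)])
  show "U * (mat_adjoint U * X) = X"
    using assms c by (simp add: unitary_mat_adjoint_right flip: assoc_mult_mat[OF c assms(2)])
qed

lemma unitary_mat_cancel_vec:
  assumes "unitary_mat n U" "x \<in> carrier_vec n"
  shows "mat_adjoint U *\<^sub>v (U *\<^sub>v x) = x" "U *\<^sub>v (mat_adjoint U *\<^sub>v x) = x"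
proof -
  have c: "U \<in> carrier_mat n n" "mat_adjoint U \<in> carrier_mat n n"
    using assms mat_adjoint_carrier by (auto simp: unitary_mat_def)
  show "mat_adjoint U *\<^sub>v (U *\<^sub>v x) = x"
    using assms c by (simp add: unitary_mat_def flip: assoc_mult_mat_vec[OF c(2,1) assms(2)])
  show "U *\<^sub>v (mat_adjoint U *\<^sub>v x) = x"
    using assms c by (simp add: unitary_mat_adjoint_right flip: assoc_mult_mat_vec[OF c assms(2)])
qed

lemma unitary_mat_mult:
  assumes "unitary_mat n U" "unitary_mat n V"
  shows "unitary_mat n (U * V)"
proof -
  have c: "U \<in> carrier_mat n n" "V \<in> carrier_mat n n" "mat_adjoint U \<in> carrier_mat n n"
    "mat_adjoint V \<in> carrier_mat n n"
    using assms mat_adjoint_carrier by (auto simp: unitary_mat_def)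
  then show ?thesis
    using assms unitary_mat_cancel(1)[OF assms(1) c(2)]
    by (simp add: unitary_mat_def mat_adjoint_mult[of _ n] assoc_mult_mat[of _ n n _ n _ n])
qed

lemma unitary_mat_adjoint:
  "unitary_mat n U \<Longrightarrow> unitary_mat n (mat_adjoint U)"
  using unitary_mat_adjoint_right
  by (auto simp: unitary_mat_def mat_adjoint_carrier mat_adjoint_adjoint[where n = n])

lemma det_mat_adjoint:
  fixes A :: "complex mat"
  assumes "A \<in> carrier_mat n n"
  shows "det (mat_adjoint A) = cnj (det A)"
proof -
  interpret comm_ring_hom cnj by unfold_locales auto
  have "mat_adjoint A = map_mat cnj (transpose_mat A)"
    using assms mat_adjoint_carrier[OF assms]
    by (intro eq_matI) (auto simp: index_mat_adjoint[where n = n])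
  then show ?thesis
    using assms by (simp add: hom_det det_transpose)
qed

lemma unitary_mat_det:
  assumes "unitary_mat n U"
  shows "cnj (det U) * det U = 1"
  using assms det_mult[of "mat_adjoint U" n U]
  by (simp add: unitary_mat_def mat_adjoint_carrier det_mat_adjoint[where n = n])

section \<open>Diagonal matrices\<close>

lemma det_mat_diag: "det (mat_diag n f) = (\<Prod>i<n. f i :: complex)"
proof -
  have "det (mat_diag n f) = prod_list (diag_mat (mat_diag n f))"
    by (rule det_upper_triangular[of _ n]) (auto simp: mat_diag_def)
  also have "diag_mat (mat_diag n f) = map f [0..<n]"
    by (auto simp: diag_mat_def mat_diag_def)
  finally show ?thesis
    by (simp add: prod.list_conv_set_nth atLeast0LessThan)
qed

lemma mat_adjoint_mat_diag: "mat_adjoint (mat_diag n f :: complex mat) = mat_diag n (\<lambda>i. cnj (f i))"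
proof -
  have "mat_diag n f \<in> carrier_mat n n" by simp
  from mat_adjoint_carrier[OF this] show ?thesis
    by (intro eq_matI) (auto simp: index_mat_adjoint[where n = n] mat_diag_def)
qed

lemma unitary_mat_diag: "unitary_mat n (mat_diag n f) \<longleftrightarrow> (\<forall>i<n. cnj (f i) * f i = 1)"
proof
  assume "unitary_mat n (mat_diag n f)"
  then have "mat_diag n (\<lambda>i. cnj (f i) * f i) = 1\<^sub>m n"
    by (simp add: unitary_mat_def mat_adjoint_mat_diag)
  then have "mat_diag n (\<lambda>i. cnj (f i) * f i) $$ (i, i) = 1" if "i < n" for i
    using that by simp
  then show "\<forall>i<n. cnj (f i) * f i = 1"
    by (simp add: mat_diag_def)
next
  assume "\<forall>i<n. cnj (f i) * f i = 1"
  then show "unitary_mat n (mat_diag n f)"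
    unfolding unitary_mat_def mat_adjoint_mat_diag mat_diag_diag
    by (auto simp: mat_diag_def)
qed

section \<open>Extending a vector to an orthonormal basis\<close>

text \<open>Complete \<open>v\<close> to a basis that starts with \<open>v\<close> and orthogonalize
  it; Gram-Schmidt leaves the first vector unchanged. The normalized vectors are the columns of
  \<open>U\<close>, and \<open>c\<close> is the norm of \<open>v\<close>.\<close>

lemma unitary_completion:
  fixes v :: "complex vec"
  assumes v: "v \<in> carrier_vec n" and v0: "v \<noteq> 0\<^sub>v n"
  obtains U c where "unitary_mat n U" "c \<noteq> 0" "v = c \<cdot>\<^sub>v col U 0"
proof -
  interpret cof_vec_space n "TYPE(complex)" .
  define b where "b = basis_completion v"
  define ws where "ws = gram_schmidt n b"
  have n: "n \<noteq> 0"
    using v v0 by (intro notI) auto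
  note bc = basis_completion[OF v v0, folded b_def]
  obtain vs where bv: "b = v # vs"
    using bc(6,7) n by (cases b) auto
  note gs = gram_schmidt_result[OF bc(2,4,5) refl, folded ws_def]
  have len: "length ws = n" using gs(4) bc(6) by simp
  have hd: "ws ! 0 = v"
    using gram_schmidt_hd[OF v, of vs, folded bv ws_def] len n by (subst hd_conv_nth[symmetric]) auto
  have wc: "ws ! i \<in> carrier_vec n" if "i < n" for i
    using gs(3) len that by auto
  define r where "r i = complex_of_real (sqrt (Re (ws ! i \<bullet>c ws ! i)))" for i
  have rr: "r i * r i = ws ! i \<bullet>c ws ! i" if "i < n" for i
  proof -
    \<comment> \<open>In the order on the complex numbers, being at least 0 includes having
      imaginary part 0, so taking \<open>Re\<close> in the norm \<open>r i\<close> loses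
      nothing.\<close>
    have "0 \<le> ws ! i \<bullet>c ws ! i" by (rule conjugate_square_ge_0_vec)
    then show ?thesis
      by (auto simp: r_def less_eq_complex_def complex_eq_iff simp flip: of_real_mult)
  qed
  have r0: "r i \<noteq> 0" if "i < n" for i
    using rr[OF that] corthogonalD[OF gs(2), of i i] that len by auto
  define U where "U = Matrix.mat n n (\<lambda>(i, j). ws ! j $ i / r j)"
  have U: "U \<in> carrier_mat n n" by (simp add: U_def)
  have "mat_adjoint U * U = 1\<^sub>m n"
  proof (rule eq_matI)
    fix i j assume "i < dim_row (1\<^sub>m n :: complex mat)" "j < dim_col (1\<^sub>m n :: complex mat)"
    then have ij: "i < n" "j < n" by auto
    have "(mat_adjoint U * U) $$ (i, j) = (\<Sum>k<n. cnj (ws ! i $ k / r i) * (ws ! j $ k / r j))"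
      using ij U mat_adjoint_carrier[OF U]
      by (simp add: scalar_prod_def index_mat_adjoint[where n = n] U_def atLeast0LessThan)
    also have "\<dots> = (\<Sum>k<n. ws ! j $ k * cnj (ws ! i $ k)) / (r i * r j)"
      by (simp add: sum_divide_distrib r_def mult.commute)
    also have "(\<Sum>k<n. ws ! j $ k * cnj (ws ! i $ k)) = ws ! j \<bullet>c ws ! i"
      using wc[OF ij(1)] wc[OF ij(2)] by (simp add: scalar_prod_def atLeast0LessThan)
    also have "\<dots> / (r i * r j) = 1\<^sub>m n $$ (i, j)"
      using ij rr[of i] r0[of i] corthogonalD[OF gs(2), of j i] len by auto
    finally show "(mat_adjoint U * U) $$ (i, j) = 1\<^sub>m n $$ (i, j)" .
  qed (use U mat_adjoint_carrier[OF U] in auto)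
  then have "unitary_mat n U" using U by (simp add: unitary_mat_def)
  moreover have "v = r 0 \<cdot>\<^sub>v col U 0"
    using v hd n r0[of 0] by (intro eq_vecI) (auto simp: U_def)
  ultimately show thesis using that r0[of 0] n by blast
qed

section \<open>Spectral theorem for normal matrices\<close>

text \<open>The direct sum of a scalar and \<open>D\<close>, which carries the induction on the
  dimension. The corner is a \<open>mat_diag\<close> so that products of corners fall under the
  product rule for diagonal matrices.\<close>

definition bordered_mat :: "complex \<Rightarrow> complex mat \<Rightarrow> complex mat" where
  "bordered_mat a D =
     four_block_mat (mat_diag 1 (\<lambda>_. a)) (0\<^sub>m 1 (dim_col D)) (0\<^sub>m (dim_row D) 1) D"

lemma bordered_mat_carrier: "D \<in> carrier_mat m m \<Longrightarrow> bordered_mat a D \<in> carrier_mat (Suc m) (Suc m)"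
  by (auto simp: bordered_mat_def mat_diag_def)

lemma index_bordered_mat:
  assumes "D \<in> carrier_mat m m" "i < Suc m" "j < Suc m"
  shows "bordered_mat a D $$ (i, j) =
    (if i = 0 \<and> j = 0 then a else if i = 0 \<or> j = 0 then 0 else D $$ (i - 1, j - 1))"
  using assms by (auto simp: bordered_mat_def mat_diag_def)

lemma bordered_mat_mult:
  assumes "D \<in> carrier_mat m m" "E \<in> carrier_mat m m"
  shows "bordered_mat a D * bordered_mat b E = bordered_mat (a * b) (D * E)"
  using assms unfolding bordered_mat_def
  by (subst mult_four_block_mat[of _ 1 1 _ m _ m _ _ 1 _ m])
    (auto simp: left_mult_zero_mat[OF mat_diag_dim] right_mult_zero_mat[OF mat_diag_dim]
      simp del: One_nat_def)

lemma mat_adjoint_bordered_mat: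
  assumes "D \<in> carrier_mat m m"
  shows "mat_adjoint (bordered_mat a D) = bordered_mat (cnj a) (mat_adjoint D)"
  using mat_adjoint_carrier[OF bordered_mat_carrier[OF assms, of a]] bordered_mat_carrier[OF assms, of a]
    bordered_mat_carrier[OF mat_adjoint_carrier[OF assms], of "cnj a"] assms mat_adjoint_carrier[OF assms]
  by (intro eq_matI)
    (auto simp: index_mat_adjoint[where n = "Suc m"] index_mat_adjoint[where n = m]
      index_bordered_mat[where m = m])

lemma bordered_mat_inject:
  assumes "D \<in> carrier_mat m m" "E \<in> carrier_mat m m" "bordered_mat a D = bordered_mat b E"
  shows "D = E"
proof (rule eq_matI)
  fix i j assume "i < dim_row E" "j < dim_col E"
  then have ij: "Suc i < Suc m" "Suc j < Suc m" using assms by auto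
  show "D $$ (i, j) = E $$ (i, j)"
    using index_bordered_mat[OF assms(1) ij, of a] index_bordered_mat[OF assms(2) ij, of b] assms(3) by simp
qed (use assms in auto)

lemma mat_diag_Suc: "mat_diag (Suc m) f = bordered_mat (f 0) (mat_diag m (\<lambda>i. f (Suc i)))"
  by (rule eq_matI) (auto simp: bordered_mat_def mat_diag_def)

lemma unitary_bordered_mat:
  assumes "unitary_mat m P"
  shows "unitary_mat (Suc m) (bordered_mat 1 P)"
proof -
  have P: "P \<in> carrier_mat m m" using assms by (simp add: unitary_mat_def)
  have "bordered_mat 1 (1\<^sub>m m) = 1\<^sub>m (Suc m)"
    using mat_diag_Suc[of m "\<lambda>_. 1"] by simp
  then show ?thesis
    using assms P bordered_mat_carrier[OF P]
    by (simp add: unitary_mat_def mat_adjoint_bordered_mat[OF P]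
        bordered_mat_mult[OF mat_adjoint_carrier[OF P] P])
qed

text \<open>Induction on the dimension: an eigenvector is split off by a unitary change of basis,
  and normality forces the rest of the first row to vanish along with the rest of the first column.
  The remaining block is again normal.\<close>

lemma normal_mat_diagonalizable:
  fixes A :: "complex mat"
  assumes "A \<in> carrier_mat n n" "mat_adjoint A * A = A * mat_adjoint A"
  shows "\<exists>P d. unitary_mat n P \<and> A = P * mat_diag n d * mat_adjoint P"
  using assms
proof (induction n arbitrary: A)
  case 0
  have "unitary_mat 0 (1\<^sub>m 0)"
    by (simp add: unitary_mat_def mat_adjoint_one)
  moreover have "A = 1\<^sub>m 0 * mat_diag 0 (\<lambda>_. 0) * mat_adjoint (1\<^sub>m 0)"
    using 0 by (intro eq_matI) (auto simp: mat_adjoint_one mat_diag_def)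
  ultimately show ?case by blast
next
  case (Suc m)
  let ?n = "Suc m"
  have A: "A \<in> carrier_mat ?n ?n" by fact
  have A': "mat_adjoint A \<in> carrier_mat ?n ?n" by (rule mat_adjoint_carrier[OF A])
  obtain e v where ev: "v \<in> carrier_vec ?n" "v \<noteq> 0\<^sub>v ?n" "A *\<^sub>v v = e \<cdot>\<^sub>v v"
    using spectrum_non_empty[OF A] A unfolding spectrum_def eigenvalue_def eigenvector_def by auto
  obtain U c where U: "unitary_mat ?n U" and c: "c \<noteq> 0" "v = c \<cdot>\<^sub>v col U 0"
    using unitary_completion[OF ev(1,2)] .
  have Uc: "U \<in> carrier_mat ?n ?n" "mat_adjoint U \<in> carrier_mat ?n ?n"
    using U mat_adjoint_carrier by (auto simp: unitary_mat_def)
  have u: "col U 0 \<in> carrier_vec ?n" using Uc by (intro col_carrier_vec) auto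
  have Au: "A *\<^sub>v col U 0 = e \<cdot>\<^sub>v col U 0"
  proof -
    have "c \<cdot>\<^sub>v (A *\<^sub>v col U 0) = c \<cdot>\<^sub>v (e \<cdot>\<^sub>v col U 0)"
      using ev(3) A u unfolding c(2) 
      by (simp add: mult_mat_vec[of _ ?n ?n] smult_smult_assoc mult.commute)
    then have "inverse c \<cdot>\<^sub>v (c \<cdot>\<^sub>v (A *\<^sub>v col U 0)) = inverse c \<cdot>\<^sub>v (c \<cdot>\<^sub>v (e \<cdot>\<^sub>v col U 0))"
      by simp
    then show ?thesis using c(1) by (simp add: smult_smult_assoc flip: mult.assoc)
  qed
  \<comment> \<open>\<open>T\<close> is \<open>A\<close> in the orthonormal basis formed by the
    columns of \<open>U\<close>. The first of them is an eigenvector, so the first column of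
    \<open>T\<close> is \<open>e\<close> followed by zeros.\<close>
  define T where "T = mat_adjoint U * A * U"
  have T: "T \<in> carrier_mat ?n ?n" using A Uc by (simp add: T_def)
  have T': "mat_adjoint T \<in> carrier_mat ?n ?n" by (rule mat_adjoint_carrier[OF T])
  have T'_eq: "mat_adjoint T = mat_adjoint U * mat_adjoint A * U"
    using A A' Uc
    by (simp add: T_def mat_adjoint_mult[of _ ?n] mat_adjoint_adjoint[OF Uc(1)]
        assoc_mult_mat[of _ ?n ?n _ ?n _ ?n])
  have normalT: "mat_adjoint T * T = T * mat_adjoint T"
  proof -
    have "mat_adjoint T * T = mat_adjoint U * (mat_adjoint A * A) * U"
      unfolding T'_eq unfolding T_def using A A' Uc unitary_mat_cancel(2)[OF U, of "A * U" ?n]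
      by (simp add: assoc_mult_mat[of _ ?n ?n _ ?n _ ?n])
    also have "\<dots> = T * mat_adjoint T"
      unfolding T'_eq unfolding Suc.prems(2) T_def
      using A A' Uc unitary_mat_cancel(2)[OF U, of "mat_adjoint A * U" ?n]
      by (simp add: assoc_mult_mat[of _ ?n ?n _ ?n _ ?n])
    finally show ?thesis .
  qed
  have T_col: "T $$ (i, 0) = (if i = 0 then e else 0)" if i: "i < ?n" for i
  proof -
    have "T $$ (i, 0) = (mat_adjoint U * (A * U)) $$ (i, 0)"
      using A Uc by (simp add: T_def assoc_mult_mat[of _ ?n ?n _ ?n _ ?n])
    also have "\<dots> = row (mat_adjoint U) i \<bullet> col (A * U) 0"
      using i A Uc by simp
    also have "col (A * U) 0 = A *\<^sub>v col U 0"
      using A Uc by (intro col_mult2[of _ ?n ?n _ ?n]) auto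
    also have "row (mat_adjoint U) i \<bullet> (A *\<^sub>v col U 0) = e * (row (mat_adjoint U) i \<bullet> col U 0)"
      unfolding Au using i Uc u by (intro scalar_prod_smult_right) auto
    also have "row (mat_adjoint U) i \<bullet> col U 0 = (mat_adjoint U * U) $$ (i, 0)"
      using i Uc by simp
    finally show ?thesis
      using i U by (simp add: unitary_mat_def)
  qed
  have T_row: "T $$ (0, j) = 0" if j: "j < ?n" "j \<noteq> 0" for j
  proof -
    \<comment> \<open>Comparing the top left entries in the normality equation shows that first row
      and first column have the same norm. The column contributes only its corner, which the row
      shares, so nothing is left for the other entries of the row.\<close>
    have "(\<Sum>k<?n. cmod (T $$ (0, k)) ^ 2) = (\<Sum>k<?n. cmod (T $$ (k, 0)) ^ 2)"
    proof -
      have "complex_of_real (\<Sum>k<?n. cmod (T $$ (0, k)) ^ 2) = (T * mat_adjoint T) $$ (0, 0)"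
        using T T' by (simp add: scalar_prod_def index_mat_adjoint[where n = ?n] complex_norm_square
            atLeast0LessThan del: sum.lessThan_Suc of_real_power)
      also have "\<dots> = (mat_adjoint T * T) $$ (0, 0)" by (simp add: normalT)
      also have "\<dots> = complex_of_real (\<Sum>k<?n. cmod (T $$ (k, 0)) ^ 2)"
        using T T' by (simp add: scalar_prod_def index_mat_adjoint[where n = ?n] complex_norm_square
            atLeast0LessThan mult.commute del: sum.lessThan_Suc of_real_power)
      finally show ?thesis unfolding of_real_eq_iff .
    qed
    then have "(\<Sum>k<m. cmod (T $$ (0, Suc k)) ^ 2) = 0"
      by (simp add: sum.lessThan_Suc_shift T_col del: sum.lessThan_Suc)
    then have "\<forall>k<m. cmod (T $$ (0, Suc k)) ^ 2 = 0"
      by (subst (asm) sum_nonneg_eq_0_iff) auto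
    then show ?thesis using j by (cases j) auto
  qed
  define D where "D = Matrix.mat m m (\<lambda>(i, j). T $$ (Suc i, Suc j))"
  have D: "D \<in> carrier_mat m m" and D': "mat_adjoint D \<in> carrier_mat m m"
    using mat_adjoint_carrier[of D m] by (auto simp: D_def)
  have TD: "T = bordered_mat e D"
  proof (rule eq_matI)
    fix i j assume "i < dim_row (bordered_mat e D)" "j < dim_col (bordered_mat e D)"
    then have ij: "i < ?n" "j < ?n" using bordered_mat_carrier[OF D, of e] by auto
    show "T $$ (i, j) = bordered_mat e D $$ (i, j)"
      unfolding index_bordered_mat[OF D ij] using ij T_col[of i] T_row[of j] by (auto simp: D_def)
  qed (use T bordered_mat_carrier[OF D, of e] in auto)
  have "bordered_mat (cnj e * e) (mat_adjoint D * D) = bordered_mat (e * cnj e) (D * mat_adjoint D)"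
    using normalT unfolding TD mat_adjoint_bordered_mat[OF D]
    by (simp add: bordered_mat_mult[OF D D'] bordered_mat_mult[OF D' D])
  then have "mat_adjoint D * D = D * mat_adjoint D"
    using bordered_mat_inject[of "mat_adjoint D * D" m] D D' by simp
  from Suc.IH[OF D this] obtain P d where P: "unitary_mat m P" "D = P * mat_diag m d * mat_adjoint P"
    by blast
  \<comment> \<open>\<open>case_nat e d\<close> puts the split-off eigenvalue in front of those of
    the block.\<close>
  let ?V = "bordered_mat 1 P" and ?d = "case_nat e d"
  have Pc: "P \<in> carrier_mat m m" "mat_adjoint P \<in> carrier_mat m m"
    using P mat_adjoint_carrier by (auto simp: unitary_mat_def)
  have V: "unitary_mat ?n ?V" by (rule unitary_bordered_mat[OF P(1)])
  then have Vc: "?V \<in> carrier_mat ?n ?n" "mat_adjoint ?V \<in> carrier_mat ?n ?n"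
    using mat_adjoint_carrier by (auto simp: unitary_mat_def)
  have TV: "T = ?V * mat_diag ?n ?d * mat_adjoint ?V"
    unfolding TD P(2) mat_diag_Suc mat_adjoint_bordered_mat[OF Pc(1)] using Pc
    by (simp add: bordered_mat_mult[where m = m] mult_carrier_mat[of _ m m _ m])
  have "A = U * T * mat_adjoint U"
    unfolding T_def using A Uc unitary_mat_cancel(2)[OF U A] unitary_mat_adjoint_right[OF U]
    by (simp add: assoc_mult_mat[of _ ?n ?n _ ?n _ ?n])
  also have "\<dots> = (U * ?V) * mat_diag ?n ?d * mat_adjoint (U * ?V)"
    unfolding TV mat_adjoint_mult[OF Uc(1) Vc(1)] using Uc Vc mat_diag_dim[of ?n ?d]
    by (simp add: assoc_mult_mat[of _ ?n ?n _ ?n _ ?n] mult_carrier_mat[of _ ?n ?n _ ?n])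
  finally show ?case using unitary_mat_mult[OF U V] by blast
qed

section \<open>Eigenvalue multiplicities and self-duality\<close>

lemma order_prod_linear:
  fixes d :: "nat \<Rightarrow> complex"
  shows "Polynomial.order \<mu> (\<Prod>a\<leftarrow>map d [0..<n]. [:- a, 1:]) = card {i. i < n \<and> d i = \<mu>}"
proof (induction n)
  case (Suc n)
  \<comment> \<open>The exponent 1 gives the last factor the shape expected by
    \<open>order_linear_power\<close>.\<close>
  have "Polynomial.order \<mu> ((\<Prod>a\<leftarrow>map d [0..<n]. [:- a, 1:]) * [:- d n, 1:] ^ 1) =
      card {i. i < n \<and> d i = \<mu>} + Polynomial.order \<mu> ([:- d n, 1:] ^ 1)"
    unfolding Suc.IH[symmetric]
    by (rule order_mult) (auto simp: prod_list_zero_iff simp del: mult_pCons_right mult_pCons_left)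
  also have "\<dots> = card {i. i < n \<and> d i = \<mu>} + (if \<mu> = d n then 1 else 0)"
    unfolding order_linear_power by auto
  also have "\<dots> = card {i. i < Suc n \<and> d i = \<mu>}"
  proof -
    have "{i. i < Suc n \<and> d i = \<mu>} = {i. i < n \<and> d i = \<mu>} \<union> (if \<mu> = d n then {n} else {})"
      by (auto simp: less_Suc_eq)
    then show ?thesis by auto
  qed
  finally show ?case by simp
qed simp

text \<open>Translates multiplicities into numbers of indices, the form from which a permutation of
  the eigenvectors can be built.\<close>

lemma order_char_poly_diagonalized:
  assumes "unitary_mat n P" "A = P * mat_diag n d * mat_adjoint P"
  shows "Polynomial.order \<mu> (char_poly A) = card {i. i < n \<and> d i = \<mu>}"
proof -
  have P: "P \<in> carrier_mat n n" "mat_adjoint P \<in> carrier_mat n n"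
    using assms mat_adjoint_carrier by (auto simp: unitary_mat_def)
  have "similar_mat A (mat_diag n d)"
    using assms P unitary_mat_adjoint_right[OF assms(1)] mult_carrier_mat[OF P(1) mat_diag_dim]
    unfolding similar_mat_def
    by (intro exI[of _ P] exI[of _ "mat_adjoint P"] similar_mat_witI[of _ _ n])
      (auto simp: unitary_mat_def mult_carrier_mat[of _ n n _ n])
  then have "char_poly A = char_poly (mat_diag n d)" by (rule char_poly_similar)
  also have "\<dots> = (\<Prod>a\<leftarrow>diag_mat (mat_diag n d). [:- a, 1:])"
    by (rule char_poly_upper_triangular[of _ n]) (auto simp: mat_diag_def)
  also have "diag_mat (mat_diag n d) = map d [0..<n]"
    by (auto simp: diag_mat_def mat_diag_def)
  finally show ?thesis by (simp only: order_prod_linear)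
qed

lemma unitary_mat_diagonalizable:
  assumes "unitary_mat n A"
  obtains P d where "unitary_mat n P" "A = P * mat_diag n d * mat_adjoint P"
    "\<And>i. i < n \<Longrightarrow> cnj (d i) * d i = 1"
proof -
  have A: "A \<in> carrier_mat n n" using assms by (simp add: unitary_mat_def)
  obtain P d where P: "unitary_mat n P" and AP: "A = P * mat_diag n d * mat_adjoint P"
    using normal_mat_diagonalizable[OF A] assms unitary_mat_adjoint_right[OF assms]
    by (auto simp: unitary_mat_def)
  have c: "P \<in> carrier_mat n n" "mat_adjoint P \<in> carrier_mat n n" "mat_diag n d \<in> carrier_mat n n"
    using P mat_adjoint_carrier by (auto simp: unitary_mat_def)
  have "mat_diag n d = mat_adjoint P * A * P"
    using c P unitary_mat_cancel(1)[OF P c(3)]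
    by (simp add: AP assoc_mult_mat[of _ n n _ n _ n] mult_carrier_mat[of _ n n _ n]
        unitary_mat_def right_mult_one_mat[OF mat_diag_dim])
  then have "unitary_mat n (mat_diag n d)"
    using assms P by (simp add: unitary_mat_mult unitary_mat_adjoint)
  then show thesis using that P AP by (simp add: unitary_mat_diag)
qed

text \<open>The same \<open>P\<close> diagonalizes the adjoint, with conjugated eigenvalues, and on
  the unit circle conjugation is inversion. At \<open>\<mu> = 0\<close>, where
  \<open>inverse \<mu>\<close> is again 0, both sides are 0.\<close>

lemma order_char_poly_mat_adjoint:
  assumes "unitary_mat n A"
  shows "Polynomial.order \<mu> (char_poly (mat_adjoint A)) = Polynomial.order (inverse \<mu>) (char_poly A)"
proof -
  obtain P d where P: "unitary_mat n P" "A = P * mat_diag n d * mat_adjoint P"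
    and d: "\<And>i. i < n \<Longrightarrow> cnj (d i) * d i = 1"
    using unitary_mat_diagonalizable[OF assms] by metis
  have c: "P \<in> carrier_mat n n" "mat_adjoint P \<in> carrier_mat n n" "mat_diag n d \<in> carrier_mat n n"
    using P mat_adjoint_carrier by (auto simp: unitary_mat_def)
  have "mat_adjoint A = P * mat_diag n (\<lambda>i. cnj (d i)) * mat_adjoint P"
    using c by (simp add: P(2) mat_adjoint_mult[of _ n] mat_adjoint_adjoint[OF c(1)]
        mat_adjoint_mat_diag assoc_mult_mat[of _ n n _ n _ n] mult_carrier_mat[of _ n n _ n])
  then have "Polynomial.order \<mu> (char_poly (mat_adjoint A)) = card {i. i < n \<and> cnj (d i) = \<mu>}"
    by (rule order_char_poly_diagonalized[OF P(1)])
  also have "{i. i < n \<and> cnj (d i) = \<mu>} = {i. i < n \<and> d i = inverse \<mu>}"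
  proof -
    have "cnj (d i) = inverse (d i)" if "i < n" for i
      using d[OF that] by (metis inverse_unique mult.commute)
    then show ?thesis by (metis (no_types, lifting) inverse_inverse_eq)
  qed
  also have "card \<dots> = Polynomial.order (inverse \<mu>) (char_poly A)"
    by (rule order_char_poly_diagonalized[OF P, symmetric])
  finally show ?thesis .
qed

text \<open>The excepted values 1 and -1 are fixed by inversion, and at a non-root the order is 0,
  so the symmetry extends from the roots named in \<open>self_dual\<close> to every complex
  number.\<close>

lemma self_dual_iff_order:
  assumes "p \<noteq> 0"
  shows "self_dual p \<longleftrightarrow> (\<forall>\<mu>. Polynomial.order (inverse \<mu>) p = Polynomial.order \<mu> p)"
proof
  assume sd: "self_dual p"
  show "\<forall>\<mu>. Polynomial.order (inverse \<mu>) p = Polynomial.order \<mu> p"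
  proof
    fix \<mu>
    consider "\<mu> = 1 \<or> \<mu> = -1" | "\<mu> \<noteq> 1" "\<mu> \<noteq> -1" "poly p \<mu> = 0"
      | "\<mu> \<noteq> 1" "\<mu> \<noteq> -1" "poly p (inverse \<mu>) = 0" | "poly p \<mu> \<noteq> 0" "poly p (inverse \<mu>) \<noteq> 0"
      by blast
    then show "Polynomial.order (inverse \<mu>) p = Polynomial.order \<mu> p"
    proof cases
      case 3
      \<comment> \<open>Here the root is \<open>inverse \<mu>\<close>, so self-duality is applied
        there.\<close>
      then have "inverse \<mu> \<noteq> 1" "inverse \<mu> \<noteq> -1"
        by (metis inverse_inverse_eq inverse_1 inverse_minus_eq)+
      then show ?thesis
        using sd 3 unfolding self_dual_def by (metis inverse_inverse_eq)
    qed (use sd in \<open>auto simp: self_dual_def order_0I\<close>)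
  qed
next
  assume "\<forall>\<mu>. Polynomial.order (inverse \<mu>) p = Polynomial.order \<mu> p"
  then show "self_dual p"
    using assms by (auto simp: self_dual_def order_root)
qed

section \<open>Reversibility as matrix and vector equations\<close>

text \<open>Clearing the inverses leaves only products to be computed in the two concrete
  groups.\<close>

lemma (in group) reversible_iff:
  assumes "g \<in> carrier G"
  shows "reversible G g \<longleftrightarrow> (\<exists>h\<in>carrier G. g \<otimes> h \<otimes> g = h)"
proof -
  have "h \<otimes> g \<otimes> inv h = inv g \<longleftrightarrow> g \<otimes> h \<otimes> g = h" if h: "h \<in> carrier G" for h
  proof -
    have "h \<otimes> g \<otimes> inv h = inv g \<longleftrightarrow> h \<otimes> g = inv g \<otimes> h"
      using assms h by (metis inv_closed inv_solve_right m_closed)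
    also have "\<dots> \<longleftrightarrow> g \<otimes> (h \<otimes> g) = h"
      using assms h by (metis inv_closed inv_solve_left m_closed)
    finally show ?thesis using assms h by (simp add: m_assoc)
  qed
  then show ?thesis by (auto simp: reversible_def)
qed

lemma reversible_SU_iff:
  assumes "A \<in> carrier (SU n)"
  shows "reversible (SU n) A \<longleftrightarrow> (\<exists>B\<in>carrier (SU n). A * B * A = B)"
  using group.reversible_iff[OF group_SU assms] by (simp add: SU_def)

text \<open>The two components of the inverse-free equation for the conjugator
  \<open>(B, v)\<close>. The first is the equation for \<open>A\<close> in \<open>SU n\<close>, so
  (1) yields (2) at once; the second is a linear equation for \<open>v\<close> once \<open>B\<close>
  is chosen.\<close>

lemma reversible_SU_affine_iff:
  assumes "A \<in> carrier (SU n)" "w \<in> carrier_vec n"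
  shows "reversible (SU_affine n) (A, w) \<longleftrightarrow>
    (\<exists>B\<in>carrier (SU n). \<exists>v\<in>carrier_vec n. A * B * A = B \<and> A *\<^sub>v (B *\<^sub>v w) + (A *\<^sub>v v + w) = v)"
proof -
  have g: "(A, w) \<in> carrier (SU_affine n)" using assms by (simp add: SU_affine_def)
  have *: "(A * B) *\<^sub>v w + (A *\<^sub>v v + w) = A *\<^sub>v (B *\<^sub>v w) + (A *\<^sub>v v + w)"
    if "B \<in> carrier (SU n)" for B v
    using that assms by (auto simp: SU_def assoc_mult_mat_vec[of _ n n])
  show ?thesis
    unfolding group.reversible_iff[OF group_SU_affine g]
    by (auto simp: SU_affine_def Bex_def *) (blast, metis *)
qed

lemma reversible_imp_self_dual:
  assumes A: "A \<in> carrier (SU n)" and "reversible (SU n) A"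
  shows "self_dual (char_poly A)"
proof -
  obtain B where B: "B \<in> carrier (SU n)" "A * B * A = B"
    using assms reversible_SU_iff by blast
  have U: "unitary_mat n A" "unitary_mat n B" using A B by (auto simp: carrier_SU_iff)
  have c: "A \<in> carrier_mat n n" "mat_adjoint A \<in> carrier_mat n n"
     "B \<in> carrier_mat n n" "mat_adjoint B \<in> carrier_mat n n"
    using U mat_adjoint_carrier by (auto simp: unitary_mat_def)
  have "B * A = mat_adjoint A * B"
    using arg_cong[OF B(2), of "\<lambda>X. mat_adjoint A * X"] c
      unitary_mat_cancel(1)[OF U(1), of "B * A" n]
    by (simp add: assoc_mult_mat[of _ n n _ n _ n] mult_carrier_mat[of _ n n _ n])
  then have "B * A * mat_adjoint B = mat_adjoint A"
    using c unitary_mat_adjoint_right[OF U(2)]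
    by (simp add: assoc_mult_mat[of _ n n _ n _ n] mult_carrier_mat[of _ n n _ n])
  then have "similar_mat (mat_adjoint A) A"
    unfolding similar_mat_def using c U(2) unitary_mat_adjoint_right[OF U(2)]
    by (intro exI[of _ B] exI[of _ "mat_adjoint B"] similar_mat_witI[of _ _ n]) (auto simp: unitary_mat_def)
  then have "char_poly (mat_adjoint A) = char_poly A" by (rule char_poly_similar)
  \<comment> \<open>The adjoint shares the characteristic polynomial of \<open>A\<close> by
    similarity, while its multiplicities are those of \<open>A\<close> at inverted
    arguments.\<close>
  then have "Polynomial.order (inverse \<mu>) (char_poly A) = Polynomial.order \<mu> (char_poly A)" for \<mu>
    using order_char_poly_mat_adjoint[OF U(1), of \<mu>] by simp
  moreover have "char_poly A \<noteq> 0" using degree_monic_char_poly[OF c(1)] by auto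
  ultimately show ?thesis by (simp add: self_dual_iff_order)
qed

section \<open>Weighted permutation matrices\<close>

text \<open>The map taking the \<open>j\<close>-th basis vector to \<open>c j\<close> times the
  \<open>p j\<close>-th one: weights belong to columns, not rows.\<close>

definition monomial_mat :: "nat \<Rightarrow> (nat \<Rightarrow> nat) \<Rightarrow> (nat \<Rightarrow> complex) \<Rightarrow> complex mat" where
  "monomial_mat n p c = Matrix.mat n n (\<lambda>(i, j). if i = p j then c j else 0)"

lemma monomial_mat_carrier [simp]: "monomial_mat n p c \<in> carrier_mat n n"
  by (simp add: monomial_mat_def)

lemma monomial_mat_diag: "monomial_mat n p c * mat_diag n a = monomial_mat n p (\<lambda>j. c j * a j)"
  by (subst mat_diag_mult_right[OF monomial_mat_carrier]) (auto simp: monomial_mat_def)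

lemma mat_diag_monomial:
  assumes "p permutes {..<n}"
  shows "mat_diag n a * monomial_mat n p c = monomial_mat n p (\<lambda>j. a (p j) * c j)"
  by (subst mat_diag_mult_left[OF monomial_mat_carrier]) (auto simp: monomial_mat_def)

lemma unitary_monomial_mat:
  assumes p: "p permutes {..<n}" and c: "\<And>j. j < n \<Longrightarrow> cnj (c j) * c j = 1"
  shows "unitary_mat n (monomial_mat n p c)"
proof -
  have "mat_adjoint (monomial_mat n p c) * monomial_mat n p c = 1\<^sub>m n" (is "?L = _")
  proof (rule eq_matI)
    fix i j assume "i < dim_row (1\<^sub>m n :: complex mat)" "j < dim_col (1\<^sub>m n :: complex mat)"
    then have ij: "i < n" "j < n" by auto
    then have pn: "p i < n" using permutes_in_image[OF p, of i] by simp
    have "?L $$ (i, j) = (\<Sum>k<n. cnj (if k = p i then c i else 0) * (if k = p j then c j else 0))"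
      using ij mat_adjoint_carrier[OF monomial_mat_carrier[of n p c]]
        carrier_matD[OF monomial_mat_carrier[of n p c]]
      by (simp add: scalar_prod_def index_mat_adjoint[where n = n] atLeast0LessThan)
        (simp add: monomial_mat_def)
    also have "\<dots> = (\<Sum>k<n. if k = p i then (if p i = p j then cnj (c i) * c j else 0) else 0)"
      by (intro sum.cong) auto
    also have "\<dots> = (if p i = p j then cnj (c i) * c j else 0)"
      using pn by simp
    also have "p i = p j \<longleftrightarrow> i = j"
      using permutes_inj[OF p] by (auto dest: injD)
    finally show "?L $$ (i, j) = 1\<^sub>m n $$ (i, j)"
      using ij c by auto
  qed (use mat_adjoint_carrier[OF monomial_mat_carrier[of n p c]]
        carrier_matD[OF monomial_mat_carrier[of n p c]] in auto)
  then show ?thesis by (simp add: unitary_mat_def)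
qed

text \<open>Meant for the indices of eigenvalue 1, which the permutation will fix. By injectivity of
  \<open>p\<close> no other column reaches row \<open>i\<close>.\<close>

lemma monomial_mat_fixed:
  assumes p: "p permutes {..<n}" and i: "i < n" "p i = i" and x: "x \<in> carrier_vec n"
  shows "(monomial_mat n p c *\<^sub>v x) $ i = c i * x $ i"
proof -
  have "(monomial_mat n p c *\<^sub>v x) $ i = (\<Sum>j<n. (if i = p j then c j else 0) * x $ j)"
    using i x by (simp add: monomial_mat_def scalar_prod_def atLeast0LessThan)
  also have "\<dots> = (\<Sum>j<n. if j = i then c i * x $ i else 0)"
  proof (intro sum.cong refl)
    fix j
    have "i = p j \<longleftrightarrow> j = i" using i permutes_inj[OF p] by (metis injD)
    then show "(if i = p j then c j else 0) * x $ j = (if j = i then c i * x $ i else 0)" by simp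
  qed
  also have "\<dots> = c i * x $ i" using i by simp
  finally show ?thesis .
qed

section \<open>Construction of the reversing element\<close>

text \<open>Equal multiplicities say that the multiset of eigenvalues is invariant under inversion,
  and equal images of multisets are matched by a permutation. Applying this only to the indices in
  \<open>S\<close>, where the eigenvalue is not 1, makes the permutation fix all the others.\<close>

lemma eigenvalue_inversion_permutation:
  fixes d :: "nat \<Rightarrow> complex"
  assumes "\<And>\<mu>. card {i. i < n \<and> d i = inverse \<mu>} = card {i. i < n \<and> d i = \<mu>}"
  obtains p where "p permutes {..<n}" "\<And>i. i < n \<Longrightarrow> d (p i) = inverse (d i)"
    "\<And>i. d i = 1 \<Longrightarrow> p i = i"
proof -
  define S where "S = {i. i < n \<and> d i \<noteq> 1}"
  have S: "finite S" by (simp add: S_def)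
  have "image_mset d (mset_set S) = image_mset (\<lambda>i. inverse (d i)) (mset_set S)"
  proof (rule multiset_eqI)
    fix \<mu>
    have "{i \<in> S. d i = \<mu>} = (if \<mu> = 1 then {} else {i. i < n \<and> d i = \<mu>})"
      by (auto simp: S_def)
    moreover have "{i \<in> S. inverse (d i) = \<mu>} = (if \<mu> = 1 then {} else {i. i < n \<and> d i = inverse \<mu>})"
      by (auto simp: S_def)
    ultimately show "count (image_mset d (mset_set S)) \<mu> =
        count (image_mset (\<lambda>i. inverse (d i)) (mset_set S)) \<mu>"
      using S assms[of \<mu>] by (simp add: count_image_mset_eq_card_vimage)
  qed
  then have "image_mset (\<lambda>i. inverse (d i)) (mset_set S) = image_mset d (mset_set S)" ..
  from image_mset_eq_implies_permutes[OF S this] obtain p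
    where p: "p permutes S" "\<forall>i\<in>S. inverse (d i) = d (p i)" .
  have "p permutes {..<n}" using p(1) by (rule permutes_subset) (auto simp: S_def)
  moreover have "d (p i) = inverse (d i)" if "i < n" for i
    using p that permutes_not_in[OF p(1), of i] by (cases "i \<in> S") (auto simp: S_def)
  moreover have "p i = i" if "d i = 1" for i
    using permutes_not_in[OF p(1), of i] that by (auto simp: S_def)
  ultimately show thesis using that by blast
qed

text \<open>In eigenvector coordinates the vector equation splits into one scalar equation per
  index, \<open>(1 - d i) * y i = d i * (Q x) i + x i\<close>, where only \<open>d i = 1\<close> can
  obstruct a solution.\<close>

lemma diagonal_reversal:
  fixes d :: "nat \<Rightarrow> complex" and x :: "complex vec"
  assumes d: "\<And>i. i < n \<Longrightarrow> d i \<noteq> 0"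
    and card: "\<And>\<mu>. card {i. i < n \<and> d i = inverse \<mu>} = card {i. i < n \<and> d i = \<mu>}"
    and k: "k < n" "d k \<noteq> 1" and x: "x \<in> carrier_vec n"
  obtains Q y where "unitary_mat n Q" "det Q = 1" "mat_diag n d * Q * mat_diag n d = Q"
    "y \<in> carrier_vec n" "mat_diag n d *\<^sub>v (Q *\<^sub>v x) + (mat_diag n d *\<^sub>v y + x) = y"
proof -
  obtain p where p: "p permutes {..<n}" "\<And>i. i < n \<Longrightarrow> d (p i) = inverse (d i)"
    and p_fix: "\<And>i. d i = 1 \<Longrightarrow> p i = i"
    by (rule eigenvalue_inversion_permutation[OF card]) blast
  \<comment> \<open>The determinant before correction. It has modulus 1, so
    \<open>inverse \<delta>\<close> is an admissible phase. Placing it at \<open>k\<close>, where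
    \<open>d k \<noteq> 1\<close>, leaves the weight -1 at all indices of eigenvalue 1.\<close>
  define \<delta> where "\<delta> = det (monomial_mat n p (\<lambda>_. -1))"
  have \<delta>: "cnj \<delta> * \<delta> = 1"
    unfolding \<delta>_def by (rule unitary_mat_det[OF unitary_monomial_mat[OF p(1)]]) simp
  define f where "f j = (if j = k then inverse \<delta> else 1)" for j
  define Q where "Q = monomial_mat n p (\<lambda>j. - f j)"
  have Qc: "Q \<in> carrier_mat n n" by (simp add: Q_def)
  have "cnj (f j) * f j = 1" for j
    using \<delta> by (simp add: f_def flip: inverse_mult_distrib)
  then have U: "unitary_mat n Q"
    unfolding Q_def by (intro unitary_monomial_mat[OF p(1)]) simp
  have "Q = monomial_mat n p (\<lambda>_. -1) * mat_diag n f"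
    by (simp add: Q_def monomial_mat_diag)
  then have "det Q = \<delta> * (\<Prod>j<n. f j)"
    by (simp add: det_mult[of _ n] \<delta>_def det_mat_diag)
  also have "\<dots> = 1"
  proof -
    have "\<delta> \<noteq> 0" using \<delta> by auto
    then show ?thesis using k by (simp add: f_def)
  qed
  finally have det: "det Q = 1" .
  \<comment> \<open>The entry of column \<open>j\<close> in row \<open>p j\<close> gets multiplied
    by \<open>d (p j) * d j\<close>, which is 1.\<close>
  have DQD: "mat_diag n d * Q * mat_diag n d = Q"
    unfolding Q_def mat_diag_monomial[OF p(1)] monomial_mat_diag
    using p(2) d by (auto simp: monomial_mat_def)
  (* Where d i = 1 the map 1 - D vanishes; there Q acts as -1, so nothing is left to solve. *)
  define y where "y = vec n (\<lambda>i. if d i = 1 then 0 else (d i * (Q *\<^sub>v x) $ i + x $ i) / (1 - d i))"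
  have y: "y \<in> carrier_vec n" by (simp add: y_def)
  have diag_vec: "(mat_diag n d *\<^sub>v z) $ i = d i * z $ i" if "z \<in> carrier_vec n" "i < n" for z i
  proof -
    have "(mat_diag n d *\<^sub>v z) $ i = (\<Sum>j<n. (if i = j then d j else 0) * z $ j)"
      using that by (simp add: mat_diag_def scalar_prod_def atLeast0LessThan)
    also have "\<dots> = (\<Sum>j<n. if j = i then d i * z $ i else 0)"
      by (intro sum.cong) auto
    also have "\<dots> = d i * z $ i" using that by simp
    finally show ?thesis .
  qed
  have "mat_diag n d *\<^sub>v (Q *\<^sub>v x) + (mat_diag n d *\<^sub>v y + x) = y"
  proof (rule eq_vecI)
    fix i assume "i < dim_vec y"
    then have i: "i < n" using y by simp
    have Qx: "Q *\<^sub>v x \<in> carrier_vec n" using Qc x by simp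
    have "(mat_diag n d *\<^sub>v (Q *\<^sub>v x) + (mat_diag n d *\<^sub>v y + x)) $ i =
        d i * (Q *\<^sub>v x) $ i + (d i * y $ i + x $ i)"
      using i x y Qx carrier_matD[OF mat_diag_dim[of n d]]
      by (simp add: diag_vec del: index_mult_mat_vec)
    also have "\<dots> = y $ i"
    proof (cases "d i = 1")
      case True
      then have "(Q *\<^sub>v x) $ i = - x $ i"
        unfolding Q_def using k monomial_mat_fixed[OF p(1) i p_fix[OF True] x] by (auto simp: f_def)
      then show ?thesis using True i by (simp add: y_def)
    next
      case False
      then show ?thesis using i by (simp add: y_def field_simps)
    qed
    finally show "(mat_diag n d *\<^sub>v (Q *\<^sub>v x) + (mat_diag n d *\<^sub>v y + x)) $ i = y $ i" .
  qed (use x y carrier_matD[OF mat_diag_dim[of n d]] in auto)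
  with that U det DQD y show thesis by blast
qed

text \<open>Transports \<open>diagonal_reversal\<close> back along \<open>P\<close>:
  \<open>x\<close> holds the coordinates of \<open>w\<close> in the eigenbasis, and the conjugator
  is \<open>(B, P y)\<close>.\<close>

lemma self_dual_imp_reversible_affine:
  assumes A: "A \<in> carrier (SU n)" "A \<noteq> 1\<^sub>m n" and w: "w \<in> carrier_vec n"
    and sd: "self_dual (char_poly A)"
  shows "reversible (SU_affine n) (A, w)"
proof -
  have UA: "unitary_mat n A" and Ac: "A \<in> carrier_mat n n"
    using A by (auto simp: SU_def unitary_mat_def)
  obtain P d where P: "unitary_mat n P" and AP: "A = P * mat_diag n d * mat_adjoint P"
    and d: "\<And>i. i < n \<Longrightarrow> cnj (d i) * d i = 1"
    using unitary_mat_diagonalizable[OF UA] by metis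
  let ?D = "mat_diag n d"
  have c: "P \<in> carrier_mat n n" "mat_adjoint P \<in> carrier_mat n n" "?D \<in> carrier_mat n n"
    using P mat_adjoint_carrier by (auto simp: unitary_mat_def)
  have "char_poly A \<noteq> 0" using degree_monic_char_poly[OF Ac] by auto
  then have card: "card {i. i < n \<and> d i = inverse \<mu>} = card {i. i < n \<and> d i = \<mu>}" for \<mu>
    using sd by (simp add: self_dual_iff_order order_char_poly_diagonalized[OF P AP])
  \<comment> \<open>If all eigenvalues were 1, then \<open>A\<close> would be \<open>P\<close> times
    its adjoint, that is, the identity.\<close>
  obtain k where k: "k < n" "d k \<noteq> 1"
  proof -
    have "\<not> (\<forall>i<n. d i = 1)"
    proof
      assume "\<forall>i<n. d i = 1"
      then have "?D = 1\<^sub>m n" by (auto simp: mat_diag_def)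
      then show False using A(2) AP c unitary_mat_adjoint_right[OF P] by simp
    qed
    then show thesis using that by blast
  qed
  have d0: "d i \<noteq> 0" if "i < n" for i using d[OF that] by auto
  have x: "mat_adjoint P *\<^sub>v w \<in> carrier_vec n" (is "?x \<in> _") using c w by simp
  obtain Q y where Q: "unitary_mat n Q" "det Q = 1" "?D * Q * ?D = Q"
    and y: "y \<in> carrier_vec n" "?D *\<^sub>v (Q *\<^sub>v ?x) + (?D *\<^sub>v y + ?x) = y"
    using diagonal_reversal[OF d0 card k x] by metis
  have Qc: "Q \<in> carrier_mat n n" using Q by (simp add: unitary_mat_def)
  define B where "B = P * Q * mat_adjoint P"
  have Bc: "B \<in> carrier_mat n n" using c Qc by (simp add: B_def)
  have "unitary_mat n B"
    unfolding B_def by (intro unitary_mat_mult unitary_mat_adjoint P Q)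
  \<comment> \<open>The determinants of \<open>P\<close> and of its adjoint multiply to 1, so
    \<open>B\<close> inherits the determinant of \<open>Q\<close>.\<close>
  moreover have "det B = 1"
    using c Qc Q(2) unitary_mat_det[OF P]
    by (simp add: B_def det_mult[of _ n] det_mat_adjoint[OF c(1)] mult.commute)
  ultimately have "B \<in> carrier (SU n)" by (simp add: carrier_SU_iff)
  moreover have "A * B * A = B"
  proof -
    have "A * B * A = P * (?D * Q * ?D) * mat_adjoint P"
      using c Qc P by (simp add: AP B_def assoc_mult_mat[of _ n n _ n _ n] mult_carrier_mat[of _ n n _ n]
          unitary_mat_cancel(1)[OF P, of _ n])
    then show ?thesis by (simp add: Q(3) B_def)
  qed
  moreover have "P *\<^sub>v y \<in> carrier_vec n" using c y by simp
  moreover have "A *\<^sub>v (B *\<^sub>v w) + (A *\<^sub>v (P *\<^sub>v y) + w) = P *\<^sub>v y"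
  proof -
    have "A *\<^sub>v (B *\<^sub>v w) = P *\<^sub>v (?D *\<^sub>v (Q *\<^sub>v ?x))"
      using c Qc w by (simp add: AP B_def assoc_mult_mat_vec[of _ n n _ n] mult_carrier_mat[of _ n n _ n]
          mult_mat_vec_carrier[of _ n n] unitary_mat_cancel_vec(1)[OF P])
    moreover have "A *\<^sub>v (P *\<^sub>v y) = P *\<^sub>v (?D *\<^sub>v y)"
      using c y by (simp add: AP assoc_mult_mat_vec[of _ n n _ n] mult_carrier_mat[of _ n n _ n]
          mult_mat_vec_carrier[of _ n n] unitary_mat_cancel_vec(1)[OF P])
    moreover have "w = P *\<^sub>v ?x" using unitary_mat_cancel_vec(2)[OF P w] by simp
    ultimately have "A *\<^sub>v (B *\<^sub>v w) + (A *\<^sub>v (P *\<^sub>v y) + w) =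
        P *\<^sub>v (?D *\<^sub>v (Q *\<^sub>v ?x)) + (P *\<^sub>v (?D *\<^sub>v y) + P *\<^sub>v ?x)"
      by simp
    also have "\<dots> = P *\<^sub>v (?D *\<^sub>v (Q *\<^sub>v ?x) + (?D *\<^sub>v y + ?x))"
      using c Qc w y(1) by (simp add: mult_add_distrib_mat_vec[of _ n n] mult_mat_vec_carrier[of _ n n])
    finally show ?thesis by (simp only: y(2))
  qed
  ultimately show ?thesis
    using reversible_SU_affine_iff[OF A(1) w] by blast
qed

section \<open>Translations\<close>

text \<open>Negating only the line of \<open>w\<close> would give determinant -1, so a second
  orthogonal direction is negated as well; \<open>n \<ge> 2\<close> provides it.\<close>

lemma negating_SU_involution:
  assumes n: "n \<ge> 2" and w: "w \<in> carrier_vec n"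
  obtains B where "B \<in> carrier (SU n)" "B * B = 1\<^sub>m n" "B *\<^sub>v w = - w"
proof -
  obtain U c where U: "unitary_mat n U" and wU: "w = c \<cdot>\<^sub>v col U 0"
  \<comment> \<open>The zero vector cannot start a basis; any \<open>U\<close> serves, with scalar
    0.\<close>
  proof (cases "w = 0\<^sub>v n")
    case True
    have "unitary_mat n (1\<^sub>m n)" by (simp add: unitary_mat_def mat_adjoint_one)
    moreover have "w = 0 \<cdot>\<^sub>v col (1\<^sub>m n) 0" using True n by auto
    ultimately show thesis using that by blast
  next
    case False
    then show thesis using unitary_completion[OF w] that by metis
  qed
  define f :: "nat \<Rightarrow> complex" where "f i = (if i < 2 then -1 else 1)" for i
  have ff: "f i * f i = 1" "cnj (f i) * f i = 1" for i by (simp_all add: f_def)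
  let ?D = "mat_diag n f"
  have c: "U \<in> carrier_mat n n" "mat_adjoint U \<in> carrier_mat n n" "?D \<in> carrier_mat n n"
    using U mat_adjoint_carrier by (auto simp: unitary_mat_def)
  have UD: "unitary_mat n ?D" by (simp add: unitary_mat_diag ff)
  define B where "B = U * ?D * mat_adjoint U"
  have Bc: "B \<in> carrier_mat n n"
    unfolding B_def using c by (intro mult_carrier_mat[of _ n n _ n])
  have "(\<Prod>i<n. f i) = (\<Prod>i\<in>{0, 1}. f i)"
    using n by (intro prod.mono_neutral_right) (auto simp: f_def)
  also have "\<dots> = 1" by (simp add: f_def)
  finally have "det B = 1"
    using c unitary_mat_det[OF U]
    by (simp add: B_def det_mult[of _ n] det_mat_adjoint[OF c(1)] mult.commute det_mat_diag)
  moreover have "unitary_mat n B"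
    unfolding B_def by (intro unitary_mat_mult unitary_mat_adjoint U UD)
  ultimately have "B \<in> carrier (SU n)" by (simp add: carrier_SU_iff)
  moreover have "B * B = 1\<^sub>m n"
  proof -
    have "B * B = U * (?D * ?D) * mat_adjoint U"
      using c by (simp add: B_def assoc_mult_mat[of _ n n _ n _ n] mult_carrier_mat[of _ n n _ n]
          unitary_mat_cancel(1)[OF U, of _ n] del: mat_diag_diag)
    then show ?thesis using c by (simp add: ff unitary_mat_adjoint_right[OF U])
  qed
  moreover have "B *\<^sub>v w = - w"
  proof -
    have u: "col U 0 = U *\<^sub>v unit_vec n 0"
      using c n by (auto simp: scalar_prod_right_unit intro!: eq_vecI)
    have "?D *\<^sub>v unit_vec n 0 = (-1) \<cdot>\<^sub>v unit_vec n 0"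
      using n by (auto simp: mat_diag_def f_def intro!: eq_vecI)
    then have "B *\<^sub>v col U 0 = (-1) \<cdot>\<^sub>v col U 0"
      unfolding u using c
      by (simp add: B_def assoc_mult_mat_vec[of _ n n _ n] mult_carrier_mat[of _ n n _ n]
          unitary_mat_cancel_vec(1)[OF U] mult_mat_vec[of _ n n])
    then show ?thesis
      unfolding wU using c Bc n by (subst mult_mat_vec[of _ n n]) auto
  qed
  ultimately show thesis using that by blast
qed

text \<open>Conjugation by the linear involution \<open>(B, 0)\<close> turns translation by
  \<open>w\<close> into translation by \<open>B w\<close>, that is, by \<open>- w\<close>.\<close>

lemma translation_strongly_reversible:
  assumes "n \<ge> 2" and w: "w \<in> carrier_vec n"
  shows "strongly_reversible (SU_affine n) (1\<^sub>m n, w)"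
proof -
  interpret group "SU_affine n" by (rule group_SU_affine)
  obtain B where B: "B \<in> carrier (SU n)" "B * B = 1\<^sub>m n" "B *\<^sub>v w = - w"
    using negating_SU_involution[OF assms] .
  have Bc: "B \<in> carrier_mat n n" using B by (simp add: SU_def)
  have B0: "B *\<^sub>v 0\<^sub>v n = 0\<^sub>v n" using Bc by (auto intro!: eq_vecI)
  let ?g = "(1\<^sub>m n, w)" and ?h = "(B, 0\<^sub>v n)"
  have g: "?g \<in> carrier (SU_affine n)" and h: "?h \<in> carrier (SU_affine n)"
    using B(1) w group.is_monoid[OF group_SU[of n]] monoid.one_closed[of "SU n"]
    by (auto simp: SU_affine_def SU_def)
  have hh: "?h \<otimes>\<^bsub>SU_affine n\<^esub> ?h = \<one>\<^bsub>SU_affine n\<^esub>"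
    using B B0 by (simp add: SU_affine_def)
  have inv_h: "inv\<^bsub>SU_affine n\<^esub> ?h = ?h" using hh h by (metis inv_equality)
  have "?h \<otimes>\<^bsub>SU_affine n\<^esub> ?g \<otimes>\<^bsub>SU_affine n\<^esub> ?h = (1\<^sub>m n, - w)"
    using B Bc w B0 by (simp add: SU_affine_def)
  moreover have "inv\<^bsub>SU_affine n\<^esub> ?g = (1\<^sub>m n, - w)"
    using g w monoid.one_closed[OF group.is_monoid[OF group_SU[of n]]]
    by (intro inv_equality) (auto simp: SU_affine_def SU_def)
  ultimately show ?thesis
    unfolding strongly_reversible_def using h hh inv_h by metis
qed

theorem theorem1p6:
  fixes n :: nat
  assumes "n \<ge> 1"
  shows "(\<forall>A w. (A, w) \<in> carrier (SU_affine n) \<and> A \<noteq> 1\<^sub>m n \<longrightarrow>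
            (reversible (SU_affine n) (A, w) \<longleftrightarrow> reversible (SU n) A) \<and>
            (reversible (SU n) A \<longleftrightarrow> self_dual (char_poly A))) \<and>
         (n \<ge> 2 \<longrightarrow>
            (\<forall>w\<in>carrier_vec n. strongly_reversible (SU_affine n) (1\<^sub>m n, w)))"
proof (intro conjI allI impI ballI)
  fix A w assume "(A, w) \<in> carrier (SU_affine n) \<and> A \<noteq> 1\<^sub>m n"
  then have A: "A \<in> carrier (SU n)" "A \<noteq> 1\<^sub>m n" and w: "w \<in> carrier_vec n"
    by (auto simp: SU_affine_def)
  \<comment> \<open>The implications form a cycle from (1) to (2) to (3) and back to (1), so (2)
    reaches (1) only through the characteristic polynomial. \<open>A \<noteq> 1\<^sub>m n\<close>
    enters in the last of them.\<close>
  have "reversible (SU_affine n) (A, w) \<Longrightarrow> reversible (SU n) A"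
    using reversible_SU_affine_iff[OF A(1) w] reversible_SU_iff[OF A(1)] by blast
  moreover have "reversible (SU n) A \<Longrightarrow> self_dual (char_poly A)"
    by (rule reversible_imp_self_dual[OF A(1)])
  moreover have "self_dual (char_poly A) \<Longrightarrow> reversible (SU_affine n) (A, w)"
    by (rule self_dual_imp_reversible_affine[OF A w])
  ultimately show "reversible (SU_affine n) (A, w) \<longleftrightarrow> reversible (SU n) A"
    "reversible (SU n) A \<longleftrightarrow> self_dual (char_poly A)"
    by blast+
next
  fix w :: "complex vec" assume "n \<ge> 2" "w \<in> carrier_vec n"
  then show "strongly_reversible (SU_affine n) (1\<^sub>m n, w)"
    by (rule translation_strongly_reversible)
qed

end
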